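(* Let $\omega$ be a point process in the plane whose distribution is invariant under a transitive group of isometries of the plane. Then the graph $G$ defined on $\omega$ by the Voronoi tessellation satisfies the regular decay property. In particular, the Poisson–Voronoi map (the Voronoi map of a homogeneous Poisson point process in the plane) has the regular decay property.
   Context: A point process is a random locally finite subset of the plane $\mathbb{R}^2$. The graph defined on $\omega$ by the Voronoi tessellation has vertex set $\omega$, and two points of $\omega$ are adjacent if their Voronoi cells are adjacent. Regular decay property: fix a point $o$ of the plane and let $B_R(o)$ be the disc of radius $R$ around $o$. An invariant random graph $G$ in the plane has the regular decay property if for every $r$ there is an $a(r)$, with $a(r)\to 0$ as $r\to\infty$, such that for any $R\ge r$, the probability that $B_R(o)$ contains the endpoints $u,v$ of an edge of $G$ with $\operatorname{dist}_{\mathbb{R}^2}(u,v)\ge a(r)R/6$ is smaller than $a(r)$. *)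

theory Defs
  imports "HOL-Probability.Probability" "HOL-Algebra.Bij"
begin

type_synonym plane = "real^2"

section \<open>Point processes\<close>

definition locally_finite :: "'b::euclidean_space set \<Rightarrow> bool" where
  "locally_finite \<omega> \<longleftrightarrow> (\<forall>B. bounded B \<longrightarrow> finite (\<omega> \<inter> B))"

text \<open>
  The usual \<open>\<sigma>\<close>-algebra on locally finite subsets, generated by the counting maps
  \<open>\<omega> \<mapsto> card (\<omega> \<inter> B)\<close>. Only bounded \<open>B\<close> are used, since the cardinality of an
  infinite set is 0 by convention.
\<close>

definition config_space :: "'b::euclidean_space set measure" where
  "config_space = sigma {\<omega>. locally_finite \<omega>}
     {{\<omega>. locally_finite \<omega> \<and> card (\<omega> \<inter> B) = k} | B k. B \<in> sets borel \<and> bounded B}"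

definition point_process :: "'a measure \<Rightarrow> ('a \<Rightarrow> plane set) \<Rightarrow> bool" where
  "point_process M X \<longleftrightarrow> prob_space M \<and> X \<in> M \<rightarrow>\<^sub>M config_space"

text \<open>
  The Poisson weights are written out because \<^const>\<open>poisson_pmf\<close> is only meaningful for
  positive rates, whereas \<open>B\<close> may be a null set (then the formula gives the point mass at 0).
\<close>

definition homogeneous_poisson_process :: "real \<Rightarrow> 'a measure \<Rightarrow> ('a \<Rightarrow> plane set) \<Rightarrow> bool" where
  "homogeneous_poisson_process lam M X \<longleftrightarrow>
     lam > 0 \<and> point_process M X \<and>
     (\<forall>B k. B \<in> sets borel \<and> bounded B \<longrightarrow>
        \<P>(x in M. card (X x \<inter> B) = k) =
          (lam * measure lborel B) ^ k / fact k * exp (- (lam * measure lborel B))) \<and>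
     (\<forall>(I :: nat set) B. finite I \<and> disjoint_family_on B I \<and>
        (\<forall>i\<in>I. B i \<in> sets borel \<and> bounded (B i)) \<longrightarrow>
        prob_space.indep_vars M (\<lambda>_. count_space UNIV) (\<lambda>i x. card (X x \<inter> B i)) I)"


section \<open>Groups of isometries and invariance\<close>

definition plane_isometries :: "(plane \<Rightarrow> plane) set" where
  "plane_isometries = {g. bij g \<and> (\<forall>x y. dist (g x) (g y) = dist x y)}"

definition transitive_isometry_group :: "(plane \<Rightarrow> plane) set \<Rightarrow> bool" where
  "transitive_isometry_group \<Gamma> \<longleftrightarrow>
     subgroup \<Gamma> (BijGroup UNIV) \<and> \<Gamma> \<subseteq> plane_isometries \<and> (\<forall>x y. \<exists>g\<in>\<Gamma>. g x = y)"

definition invariant_process ::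
    "(plane \<Rightarrow> plane) set \<Rightarrow> 'a measure \<Rightarrow> ('a \<Rightarrow> plane set) \<Rightarrow> bool" where
  "invariant_process \<Gamma> M X \<longleftrightarrow>
     (\<forall>g\<in>\<Gamma>. distr M config_space (\<lambda>x. g ` X x) = distr M config_space X)"


section \<open>Random graphs in the plane\<close>

text \<open>
  A graph consists of its vertex set and its symmetric adjacency relation. Both are locally
  finite, the latter as a subset of \<^typ>\<open>plane \<times> plane\<close>.
\<close>

type_synonym plane_graph = "plane set \<times> (plane \<times> plane) set"

definition graph_space :: "plane_graph measure" where
  "graph_space = restrict_space (config_space \<Otimes>\<^sub>M config_space)
     {(V, E). E \<subseteq> V \<times> V \<and> sym E \<and> irrefl E}"

definition graph_image :: "(plane \<Rightarrow> plane) \<Rightarrow> plane_graph \<Rightarrow> plane_graph" where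
  "graph_image g = (\<lambda>(V, E). (g ` V, map_prod g g ` E))"

definition invariant_random_graph ::
    "(plane \<Rightarrow> plane) set \<Rightarrow> 'a measure \<Rightarrow> ('a \<Rightarrow> plane_graph) \<Rightarrow> bool" where
  "invariant_random_graph \<Gamma> M G \<longleftrightarrow>
     prob_space M \<and> G \<in> M \<rightarrow>\<^sub>M graph_space \<and>
     (\<forall>g\<in>\<Gamma>. distr M graph_space (\<lambda>x. graph_image g (G x)) = distr M graph_space G)"

text \<open>
  To be used for random graphs, i.e. measurable maps into \<^const>\<open>graph_space\<close>: the event below
  says that the edge set meets a bounded Borel set, so it is then measurable.
\<close>

definition regular_decay :: "plane \<Rightarrow> 'a measure \<Rightarrow> ('a \<Rightarrow> plane_graph) \<Rightarrow> bool" where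
  "regular_decay p M G \<longleftrightarrow>
     (\<exists>a :: real \<Rightarrow> real. (a \<longlongrightarrow> 0) at_top \<and>
        (\<forall>r R. 0 < r \<and> r \<le> R \<longrightarrow>
           \<P>(x in M. \<exists>u v. (u, v) \<in> snd (G x) \<and> u \<in> cball p R \<and> v \<in> cball p R \<and>
                          dist u v \<ge> a r * R / 6) < a r))"


section \<open>Voronoi graphs\<close>

definition voronoi_cell :: "plane set \<Rightarrow> plane \<Rightarrow> plane set" where
  "voronoi_cell \<omega> u = {x. \<forall>w\<in>\<omega>. dist x u \<le> dist x w}"

text \<open>
  Cells are adjacent if they share an edge of the tessellation (a nondegenerate segment, a ray
  or a line). Cells that meet only in a corner are not adjacent, so that the graph is the planar
  dual of the tessellation even if more than three cells meet at a point.
\<close>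

definition voronoi_graph :: "plane set \<Rightarrow> plane_graph" where
  "voronoi_graph \<omega> =
     (\<omega>, {(u, v). u \<in> \<omega> \<and> v \<in> \<omega> \<and> u \<noteq> v \<and>
                  aff_dim (voronoi_cell \<omega> u \<inter> voronoi_cell \<omega> v) = 1})"

end

theory Submission
  imports Defs
begin

text \<open>
  A common side of two Voronoi cells contains the centre of an empty disc with both nuclei on its
  boundary. Shrinking that disc towards one nucleus, an edge of length at least \<open>\<delta> R / 6\<close> in the
  disc of radius \<open>R\<close> produces an empty disc of radius \<open>\<delta> R / 12\<close> in a slightly larger region, and
  hence an empty disc of half that radius around one of finitely many net points, whose number
  depends on \<open>\<delta>\<close> only. By invariance and transitivity the probability that a disc of radius \<open>s\<close>
  is empty while the process is not does not depend on its centre, and it tends to 0 as \<open>s\<close> grows.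

  Both the measurability of the Voronoi graph and the invariance of the Poisson process rest on the
  fact that the events \<open>\<omega> \<inter> C = {}\<close>, \<open>C\<close> compact, generate the \<open>\<sigma>\<close>-algebra of configurations. In
  particular, the void probabilities \<open>exp (- lam |C|)\<close> suffice for the Poisson process.
\<close>

section \<open>The \<open>\<sigma>\<close>-algebra of locally finite sets\<close>

lemma pred_Bex_countable:
  assumes "countable I" "\<And>i. i \<in> I \<Longrightarrow> Measurable.pred M (\<lambda>x. P x i)"
  shows "Measurable.pred M (\<lambda>x. \<exists>i\<in>I. P x i)"
  using assms unfolding pred_def by (intro sets.sets_Collect_countable_Ex')

lemma locally_finiteD: "locally_finite \<omega> \<Longrightarrow> bounded B \<Longrightarrow> finite (\<omega> \<inter> B)"
  by (auto simp: locally_finite_def)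

text \<open>A limit point would have infinitely many points of the set in its unit ball, so there is
  none.\<close>

lemma locally_finite_imp_closed:
  fixes \<omega> :: "'b::euclidean_space set"
  assumes "locally_finite \<omega>"
  shows "closed \<omega>"
  unfolding closed_limpt
proof (intro allI impI)
  fix x assume "x islimpt \<omega>"
  then have "infinite (\<omega> \<inter> ball x 1)"
    by (simp add: islimpt_eq_infinite_ball)
  with locally_finiteD[OF assms, of "ball x 1"] show "x \<in> \<omega>"
    by simp
qed

lemma space_config_space: "space config_space = {\<omega>. locally_finite \<omega>}"
  unfolding config_space_def by (rule space_measure_of) auto

lemma measurable_card_Int:
  fixes B :: "'b::euclidean_space set"
  assumes "B \<in> sets borel" "bounded B"
  shows "(\<lambda>\<omega>. card (\<omega> \<inter> B)) \<in> config_space \<rightarrow>\<^sub>M count_space UNIV"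
proof -
  have "{\<omega>. locally_finite \<omega> \<and> card (\<omega> \<inter> B) = k} \<in> sets config_space" for k
    unfolding config_space_def using assms by (auto simp: sets_measure_of_conv)
  moreover have "(\<lambda>\<omega>. card (\<omega> \<inter> B)) -` {k} \<inter> space config_space
      = {\<omega>. locally_finite \<omega> \<and> card (\<omega> \<inter> B) = k}" for k
    by (auto simp: space_config_space)
  ultimately show ?thesis
    by (simp add: measurable_count_space_eq2_countable)
qed

lemma pred_void_config_space [measurable]:
  fixes B :: "'b::euclidean_space set"
  assumes B: "B \<in> sets borel" "bounded B"
  shows "Measurable.pred config_space (\<lambda>\<omega>. \<omega> \<inter> B = {})"
proof -
  \<comment> \<open>Infinite sets also have \<open>card\<close> equal to 0; boundedness of
    \<open>B\<close> rules them out, so that count 0 really means disjointness.\<close>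
  have "Measurable.pred config_space (\<lambda>\<omega>. card (\<omega> \<inter> B) = 0)"
    using measurable_card_Int[OF B] by measurable
  then show ?thesis
    by (rule measurable_cong[THEN iffD1, rotated])
      (use locally_finiteD[OF _ B(2)] in \<open>auto simp: space_config_space card_eq_0_iff\<close>)
qed

text \<open>
  A finite set has at least \<open>k\<close> points iff \<open>k\<close> disjoint balls with centres in a fixed dense
  set are hit, so counts are determined by void events.
\<close>

lemma card_ge_iff_separated:
  fixes D S :: "'b::euclidean_space set"
  assumes D: "closure D = UNIV" and S: "finite S"
  shows "k \<le> card S \<longleftrightarrow>
    (\<exists>n. \<exists>Q\<in>{Q. (finite Q \<and> Q \<subseteq> D) \<and> card Q = k \<and>
        (\<forall>q\<in>Q. \<forall>q'\<in>Q. q \<noteq> q' \<longrightarrow> 2 / real (Suc n) < dist q q')}.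
      \<forall>q\<in>Q. S \<inter> cball q (1 / real (Suc n)) \<noteq> {})"
    (is "_ \<longleftrightarrow> ?R")
proof
  assume "k \<le> card S"
  then obtain P where P: "P \<subseteq> S" "card P = k" "finite P"
    by (rule obtain_subset_with_card_n)
  obtain d where d: "d > 0" "\<And>x y. x \<in> P \<Longrightarrow> y \<in> P \<Longrightarrow> dist x y < d \<Longrightarrow> x = y"
    using P(3) uniform_discrete_finite_iff[of P] unfolding uniform_discrete_def by metis
  \<comment> \<open>The gap \<open>d\<close> has to absorb two displacements of less than
    \<open>1 / real (Suc n)\<close> and still leave centres more than
    \<open>2 / real (Suc n)\<close> apart, hence the factor 4.\<close>
  obtain n where n: "1 / real (Suc n) < d / 4"
    using nat_approx_posE[of "d/4"] d by auto
  have "\<exists>q\<in>D. dist q x < 1 / real (Suc n)" for x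
    using D closure_approachable[of x D] by simp
  then obtain c where c: "\<And>x. c x \<in> D" "\<And>x. dist (c x) x < 1 / real (Suc n)"
    by metis
  have sep: "2 / real (Suc n) < dist (c x) (c y)" if "x \<in> P" "y \<in> P" "x \<noteq> y" for x y
  proof -
    have "d \<le> dist x y"
      using d(2)[of x y] that by force
    also have "\<dots> \<le> dist (c x) x + dist (c x) (c y) + dist (c y) y"
      using dist_triangle[of x y "c x"] dist_triangle[of "c x" y "c y"]
      by (simp add: dist_commute)
    finally show ?thesis
      using c(2)[of x] c(2)[of y] n by linarith
  qed
  have inj: "inj_on c P"
  proof (rule inj_onI, rule ccontr)
    fix x y assume "x \<in> P" "y \<in> P" "c x = c y" "x \<noteq> y"
    with sep[of x y] show False
      by (simp add: divide_less_0_iff)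
  qed
  show ?R
  proof (intro exI[of _ n] bexI[of _ "c ` P"] ballI)
    show "S \<inter> cball q (1 / real (Suc n)) \<noteq> {}" if "q \<in> c ` P" for q
      using that P(1) c(2) by (force simp: less_imp_le)
    show "c ` P \<in> {Q. (finite Q \<and> Q \<subseteq> D) \<and> card Q = k \<and>
        (\<forall>q\<in>Q. \<forall>q'\<in>Q. q \<noteq> q' \<longrightarrow> 2 / real (Suc n) < dist q q')}"
      using P inj c(1) sep by (auto simp: card_image)
  qed
next
  assume ?R
  then obtain n Q where Q: "finite Q" "card Q = k"
    "\<And>q q'. q \<in> Q \<Longrightarrow> q' \<in> Q \<Longrightarrow> q \<noteq> q' \<Longrightarrow> 2 / real (Suc n) < dist q q'"
    "\<And>q. q \<in> Q \<Longrightarrow> S \<inter> cball q (1 / real (Suc n)) \<noteq> {}"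
    by (smt (verit) mem_Collect_eq)
  then have "\<forall>q\<in>Q. \<exists>s. s \<in> S \<and> dist q s \<le> 1 / real (Suc n)"
    by fastforce
  then obtain s where s: "\<And>q. q \<in> Q \<Longrightarrow> s q \<in> S" "\<And>q. q \<in> Q \<Longrightarrow> dist q (s q) \<le> 1 / real (Suc n)"
    by metis
  have "inj_on s Q"
  proof (rule inj_onI, rule ccontr)
    fix q q' assume q: "q \<in> Q" "q' \<in> Q" "s q = s q'" "q \<noteq> q'"
    have "dist q q' \<le> dist q (s q) + dist q' (s q')"
      using dist_triangle2[of q q' "s q"] q(3) by simp
    also have "\<dots> \<le> 1 / real (Suc n) + 1 / real (Suc n)"
      using s(2)[OF q(1)] s(2)[OF q(2)] by (rule add_mono)
    finally show False
      using Q(3)[OF q(1,2,4)] by simp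
  qed
  with card_inj_on_le[of s Q S] s(1) S Q(2) show "k \<le> card S"
    by auto
qed

text \<open>By the separation criterion, having at least \<open>k\<close> points is a countable
  union, over \<open>n\<close> and the finite subsets of a countable dense set, of finite
  intersections of hitting events. An exact count is the difference of two consecutive such
  events.\<close>

lemma measurable_card_Int_compact:
  fixes f :: "'a \<Rightarrow> 'b::euclidean_space set"
  assumes lf: "\<And>x. x \<in> space M \<Longrightarrow> locally_finite (f x)"
    and void: "\<And>C. compact C \<Longrightarrow> Measurable.pred M (\<lambda>x. f x \<inter> C = {})"
    and C: "compact C"
  shows "(\<lambda>x. card (f x \<inter> C)) \<in> M \<rightarrow>\<^sub>M count_space UNIV"
proof -
  obtain D :: "'b set" where D: "countable D" "UNIV \<subseteq> closure D"
    using separable[of UNIV] by metis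
  let ?Q = "\<lambda>n k. {Q. (finite Q \<and> Q \<subseteq> D) \<and> card Q = k \<and>
        (\<forall>q\<in>Q. \<forall>q'\<in>Q. q \<noteq> q' \<longrightarrow> 2 / real (Suc n) < dist q q')}"
  have cQ: "countable (?Q n k)" for n k
    by (rule countable_subset[OF _ countable_Collect_finite_subset[OF D(1)]]) blast
  have "Measurable.pred M (\<lambda>x. (f x \<inter> C) \<inter> cball q r \<noteq> {})" for q r
    using void[of "C \<inter> cball q r"] C by (simp add: compact_Int_closed Int_assoc)
  then have "Measurable.pred M (\<lambda>x. \<exists>n. \<exists>Q\<in>?Q n k. \<forall>q\<in>Q. f x \<inter> C \<inter> cball q (1 / real (Suc n)) \<noteq> {})" for k
    by (intro pred_intros_countable(2) pred_Bex_countable cQ pred_intros_finite(3)) auto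
  then have "Measurable.pred M (\<lambda>x. k \<le> card (f x \<inter> C))" for k
    by (rule measurable_cong[THEN iffD1, rotated])
      (rule card_ge_iff_separated[symmetric],
       use D lf locally_finiteD compact_imp_bounded[OF C] in auto)
  then have "Measurable.pred M (\<lambda>x. k \<le> card (f x \<inter> C) \<and> \<not> Suc k \<le> card (f x \<inter> C))" for k
    by measurable
  moreover have "k \<le> c \<and> \<not> Suc k \<le> c \<longleftrightarrow> c = k" for k c :: nat
    by auto
  ultimately have "Measurable.pred M (\<lambda>x. card (f x \<inter> C) = k)" for k
    by simp
  then have "{x \<in> space M. card (f x \<inter> C) = k} \<in> sets M" for k
    by (simp add: pred_def)
  then show ?thesis
    by (simp add: measurable_count_space_eq2_countable vimage_def Int_def conj_commute)
qed

text \<open>Inside a fixed ball, counts of closed sets are counts of compact sets. Closed sets form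
  an intersection-stable generator of the Borel sets, so Dynkin's argument carries measurability
  over to all Borel sets.\<close>

lemma measurable_config_spaceI:
  fixes f :: "'a \<Rightarrow> 'b::euclidean_space set"
  assumes lf: "\<And>x. x \<in> space M \<Longrightarrow> locally_finite (f x)"
    and void: "\<And>C. compact C \<Longrightarrow> Measurable.pred M (\<lambda>x. f x \<inter> C = {})"
  shows "f \<in> M \<rightarrow>\<^sub>M config_space"
proof -
  have fin: "finite (f x \<inter> (A \<inter> cball 0 r))" if "x \<in> space M" for x A r
    using locally_finiteD[OF lf[OF that], of "A \<inter> cball 0 r"] by (simp add: bounded_Int)
  \<comment> \<open>Counts are written as values of the counting measure to have countable
    additivity at hand for disjoint unions. Truncation by \<open>cball 0 r\<close> keeps them
    finite, as the subtraction in the complement case requires.\<close>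
  have count: "(\<lambda>x. emeasure (count_space UNIV) (f x \<inter> (A \<inter> cball 0 r))) \<in> borel_measurable M"
    (is "?P A") if "A \<in> sets borel" for A r
  proof -
    have closed: "?P A" if "closed A" for A
    proof -
      have "compact (A \<inter> cball 0 r)"
        using that by (simp add: closed_Int_compact)
      from measurable_card_Int_compact[OF lf void this]
      have "(\<lambda>x. of_nat (card (f x \<inter> (A \<inter> cball 0 r))) :: ennreal) \<in> borel_measurable M"
        by measurable
      then show ?thesis
        by (rule measurable_cong[THEN iffD1, rotated]) (simp add: fin emeasure_count_space_finite)
    qed
    have "Int_stable (Collect closed :: 'b set set)" "Collect closed \<subseteq> Pow (UNIV :: 'b set)"
      by (auto simp: Int_stable_def)
    moreover from that have "A \<in> sigma_sets UNIV (Collect closed)"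
      by (simp add: borel_eq_closed)
    ultimately show ?thesis
    proof (induction rule: sigma_sets_induct_disjoint)
      case (basic A)
      then show ?case using closed by simp
    next
      case (compl A)
      have "(\<lambda>x. emeasure (count_space UNIV) (f x \<inter> (UNIV \<inter> cball 0 r))
             - emeasure (count_space UNIV) (f x \<inter> (A \<inter> cball 0 r))) \<in> borel_measurable M"
        using closed[of UNIV] compl.IH by simp
      then show ?case
      proof (rule measurable_cong[THEN iffD1, rotated])
        fix x assume x: "x \<in> space M"
        have "emeasure (count_space UNIV) ((f x \<inter> (UNIV \<inter> cball 0 r)) - (f x \<inter> (A \<inter> cball 0 r)))
            = emeasure (count_space UNIV) (f x \<inter> (UNIV \<inter> cball 0 r))
             - emeasure (count_space UNIV) (f x \<inter> (A \<inter> cball 0 r))"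
          using fin[OF x, of A r] by (intro emeasure_Diff) auto
        moreover have "(f x \<inter> (UNIV \<inter> cball 0 r)) - (f x \<inter> (A \<inter> cball 0 r)) = f x \<inter> ((UNIV - A) \<inter> cball 0 r)"
          by auto
        ultimately show "emeasure (count_space UNIV) (f x \<inter> (UNIV \<inter> cball 0 r))
             - emeasure (count_space UNIV) (f x \<inter> (A \<inter> cball 0 r))
           = emeasure (count_space UNIV) (f x \<inter> ((UNIV - A) \<inter> cball 0 r))"
          by metis
      qed
    next
      case (union A)
      have "(\<Sum>i. emeasure (count_space UNIV) (f x \<inter> (A i \<inter> cball 0 r)))
          = emeasure (count_space UNIV) (\<Union>i. f x \<inter> (A i \<inter> cball 0 r))" for x
        using union(1) by (intro suminf_emeasure) (auto simp: disjoint_family_on_def)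
      moreover have "(\<Union>i. f x \<inter> (A i \<inter> cball 0 r)) = f x \<inter> ((\<Union>i. A i) \<inter> cball 0 r)" for x
        by auto
      moreover have "(\<lambda>x. \<Sum>i. emeasure (count_space UNIV) (f x \<inter> (A i \<inter> cball 0 r))) \<in> borel_measurable M"
        using union(3) by simp
      ultimately show ?case
        by simp
    qed simp
  qed
  show ?thesis
    unfolding config_space_def
  proof (rule measurable_measure_of)
    fix Y assume "Y \<in> {{\<omega>. locally_finite \<omega> \<and> card (\<omega> \<inter> B) = k} | B k. B \<in> sets borel \<and> bounded (B :: 'b set)}"
    then obtain B k where Y: "Y = {\<omega>. locally_finite \<omega> \<and> card (\<omega> \<inter> B) = k}"
      and B: "B \<in> sets borel" "bounded (B :: 'b set)"
      by auto
    \<comment> \<open>A bounded set lies in some ball, and truncation by that ball does not change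
      it.\<close>
    obtain r where "B \<subseteq> cball 0 r"
      using bounded_subset_ballD[OF B(2)] ball_subset_cball by (metis subset_trans)
    then have B': "B \<inter> cball 0 r = B"
      by auto
    have "Measurable.pred M (\<lambda>x. emeasure (count_space UNIV) (f x \<inter> (B \<inter> cball 0 r)) = of_nat k)"
      using count[OF B(1)] by measurable
    moreover have "f -` Y \<inter> space M
        = {x \<in> space M. emeasure (count_space UNIV) (f x \<inter> (B \<inter> cball 0 r)) = of_nat k}"
      using lf fin[of _ B r] B' by (auto simp: Y emeasure_count_space_finite)
    ultimately show "f -` Y \<inter> space M \<in> sets M"
      by (simp add: pred_def)
  qed (use lf in auto)
qed

text \<open>One inclusion is the measurability criterion applied to the identity map out of the
  \<sigma>-algebra generated by the void events; the other is the measurability of each void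
  event.\<close>

lemma sets_config_space_void:
  "sets (config_space :: 'b::euclidean_space set measure) =
    sigma_sets {\<omega>. locally_finite \<omega>} {{\<omega>. locally_finite \<omega> \<and> \<omega> \<inter> C = {}} | C. compact C}"
    (is "_ = sigma_sets ?\<Omega> ?E")
proof
  have sp: "space (sigma ?\<Omega> ?E) = ?\<Omega>" and st: "sets (sigma ?\<Omega> ?E) = sigma_sets ?\<Omega> ?E"
    by (auto intro!: space_measure_of sets_measure_of)
  have "(\<lambda>x. x) \<in> sigma ?\<Omega> ?E \<rightarrow>\<^sub>M config_space"
  proof (rule measurable_config_spaceI)
    fix C :: "'b set" assume "compact C"
    then have "{x. locally_finite x \<and> x \<inter> C = {}} \<in> sigma_sets ?\<Omega> ?E"
      by blast
    then show "Measurable.pred (sigma ?\<Omega> ?E) (\<lambda>x. x \<inter> C = {})"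
      by (simp add: pred_def sp st)
  qed (use sp in auto)
  from measurable_sets[OF this] show "sets config_space \<subseteq> sigma_sets ?\<Omega> ?E"
  proof -
    assume *: "\<And>A. A \<in> sets config_space \<Longrightarrow> (\<lambda>x. x) -` A \<inter> space (sigma ?\<Omega> ?E) \<in> sets (sigma ?\<Omega> ?E)"
    show ?thesis
    proof
      fix A :: "'b set set" assume A: "A \<in> sets config_space"
      from sets.sets_into_space[OF A] have "(\<lambda>x. x) -` A \<inter> space (sigma ?\<Omega> ?E) = A"
        by (auto simp: sp space_config_space)
      with *[OF A] show "A \<in> sigma_sets ?\<Omega> ?E"
        by (simp add: st)
    qed
  qed
  have "?E \<subseteq> sets config_space"
  proof safe
    fix C :: "'b set" assume "compact C"
    then show "{\<omega>. locally_finite \<omega> \<and> \<omega> \<inter> C = {}} \<in> sets config_space"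
      using pred_void_config_space[of C]
      by (simp add: pred_def space_config_space compact_imp_bounded compact_imp_closed)
  qed
  then show "sigma_sets ?\<Omega> ?E \<subseteq> sets config_space"
    using sets.sigma_sets_subset[of ?E config_space] by (simp add: space_config_space)
qed


section \<open>Measurability of the Voronoi graph\<close>

lemma infdist_attained:
  fixes \<omega> :: "'b::euclidean_space set"
  assumes "locally_finite \<omega>" "\<omega> \<noteq> {}"
  obtains w where "w \<in> \<omega>" "infdist x \<omega> = dist x w"
  using infdist_attains_inf[OF locally_finite_imp_closed] assms by metis

text \<open>The whole space is not bounded, so emptiness of a configuration has to be expressed by
  countably many void events.\<close>

lemma disjoint_cballs_iff_empty:
  fixes \<omega> :: "'b::metric_space set"
  shows "(\<forall>n::nat. \<omega> \<inter> cball z (real n) = {}) \<longleftrightarrow> \<omega> = {}"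
  by (auto simp: disjoint_iff) (metis not_less real_arch_simple)

lemma measurable_infdist:
  fixes z :: "'b::euclidean_space"
  shows "(\<lambda>\<omega>. infdist z \<omega>) \<in> borel_measurable config_space"
  unfolding borel_measurable_iff_le
proof
  fix t :: real
  \<comment> \<open>\<open>infdist z {}\<close> is 0 by convention, so the empty configuration
    counts exactly when \<open>0 \<le> t\<close>. Otherwise the distance is attained, and being at
    most \<open>t\<close> means hitting \<open>cball z t\<close>.\<close>
  have "Measurable.pred config_space (\<lambda>\<omega>. (\<forall>n::nat. \<omega> \<inter> cball z (real n) = {}) \<and> 0 \<le> t \<or> \<omega> \<inter> cball z t \<noteq> {})"
    by measurable
  moreover have "{\<omega> \<in> space config_space. infdist z \<omega> \<le> t}
     = {\<omega> \<in> space config_space. (\<forall>n::nat. \<omega> \<inter> cball z (real n) = {}) \<and> 0 \<le> t \<or> \<omega> \<inter> cball z t \<noteq> {}}"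
  proof (rule Collect_cong, rule conj_cong[OF refl])
    fix \<omega> :: "'b set" assume "\<omega> \<in> space config_space"
    then have lf: "locally_finite \<omega>"
      by (simp add: space_config_space)
    note ne = disjoint_cballs_iff_empty[of \<omega> z]
    show "infdist z \<omega> \<le> t \<longleftrightarrow> (\<forall>n::nat. \<omega> \<inter> cball z (real n) = {}) \<and> 0 \<le> t \<or> \<omega> \<inter> cball z t \<noteq> {}"
    proof (cases "\<omega> = {}")
      case False
      then obtain w where "w \<in> \<omega>" "infdist z \<omega> = dist z w"
        using infdist_attained[OF lf] by metis
      then show ?thesis
        using False infdist_le[of _ \<omega> z] unfolding ne by fastforce
    qed (simp add: infdist_def)
  qed
  ultimately show "{\<omega> \<in> space config_space. infdist z \<omega> \<le> t} \<in> sets config_space"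
    by (simp add: pred_def)
qed

text \<open>Points of both cells are equidistant from \<open>u\<close> and \<open>v\<close>, so the
  common face lies on the perpendicular bisector and has dimension at most 1. Only the empty set and
  single points have smaller dimension.\<close>

lemma aff_dim_voronoi_face:
  fixes \<omega> :: "plane set"
  assumes uv: "u \<in> \<omega>" "v \<in> \<omega>" "u \<noteq> v"
  shows "aff_dim (voronoi_cell \<omega> u \<inter> voronoi_cell \<omega> v) = 1 \<longleftrightarrow>
    (\<exists>x y. x \<noteq> y \<and> {x, y} \<subseteq> voronoi_cell \<omega> u \<inter> voronoi_cell \<omega> v)"
    (is "aff_dim ?F = 1 \<longleftrightarrow> _")
proof -
  have sub: "?F \<subseteq> {x. (2 *\<^sub>R (v - u)) \<bullet> x = v \<bullet> v - u \<bullet> u}"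
  proof
    fix x assume "x \<in> ?F"
    then have "dist x u = dist x v"
      using uv by (auto simp: voronoi_cell_def intro: antisym)
    then have "(x - u) \<bullet> (x - u) = (x - v) \<bullet> (x - v)"
      by (simp add: dist_norm norm_eq_sqrt_inner)
    then show "x \<in> {x. (2 *\<^sub>R (v - u)) \<bullet> x = v \<bullet> v - u \<bullet> u}"
      by (simp add: inner_diff inner_commute algebra_simps)
  qed
  have "aff_dim ?F \<le> 1"
  proof -
    have "2 *\<^sub>R (v - u) \<noteq> 0"
      using uv(3) by simp
    from aff_dim_hyperplane[OF this] aff_dim_subset[OF sub] show ?thesis
      by simp
  qed
  moreover have "aff_dim ?F \<ge> -1"
    by (rule aff_dim_geq)
  ultimately have "aff_dim ?F = 1 \<longleftrightarrow> \<not> (aff_dim ?F = -1 \<or> aff_dim ?F = 0)"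
    by linarith
  also have "aff_dim ?F = -1 \<longleftrightarrow> ?F = {}"
    using aff_dim_negative_iff[of ?F] \<open>aff_dim ?F \<ge> -1\<close> by linarith
  also have "aff_dim ?F = 0 \<longleftrightarrow> (\<exists>a. ?F = {a})"
    by (rule aff_dim_eq_0)
  also have "\<not> (S = {} \<or> (\<exists>a. S = {a})) \<longleftrightarrow> (\<exists>x y. x \<noteq> y \<and> {x, y} \<subseteq> S)" for S :: "plane set"
  proof
    assume *: "\<not> (S = {} \<or> (\<exists>a. S = {a}))"
    then obtain x where x: "x \<in> S"
      by blast
    with * have "\<not> S \<subseteq> {x}"
      by blast
    with x show "\<exists>x y. x \<noteq> y \<and> {x, y} \<subseteq> S"
      by blast
  qed auto
  finally show ?thesis .
qed

lemma mem_voronoi_edges: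
  "(u, v) \<in> snd (voronoi_graph \<omega>) \<longleftrightarrow> u \<in> \<omega> \<and> v \<in> \<omega> \<and> u \<noteq> v \<and>
    (\<exists>x y. x \<noteq> y \<and> {x, y} \<subseteq> voronoi_cell \<omega> u \<inter> voronoi_cell \<omega> v)"
  using aff_dim_voronoi_face[of u \<omega> v] unfolding voronoi_graph_def by auto

text \<open>Turns cell membership into an equation between functions continuous in \<open>x\<close>,
  the form in which \<open>voronoi_defect\<close> encodes it.\<close>

lemma mem_voronoi_cell_iff:
  assumes "u \<in> \<omega>"
  shows "x \<in> voronoi_cell \<omega> u \<longleftrightarrow> dist x u = infdist x \<omega>"
proof
  assume "x \<in> voronoi_cell \<omega> u"
  then have "dist x u \<le> infdist x \<omega>"
    using assms by (auto simp: voronoi_cell_def infdist_def intro!: cINF_greatest)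
  with infdist_le[OF assms, of x] show "dist x u = infdist x \<omega>"
    by simp
qed (auto simp: voronoi_cell_def intro: infdist_le)

lemma locally_finite_voronoi_edges:
  assumes "locally_finite \<omega>"
  shows "locally_finite (snd (voronoi_graph \<omega>))"
  unfolding locally_finite_def
proof (intro allI impI)
  fix B :: "(plane \<times> plane) set" assume "bounded B"
  then have "finite (\<omega> \<inter> fst ` B)" "finite (\<omega> \<inter> snd ` B)"
    using assms by (auto intro!: locally_finiteD bounded_fst bounded_snd)
  then have "finite ((\<omega> \<inter> fst ` B) \<times> (\<omega> \<inter> snd ` B))"
    by simp
  then show "finite (snd (voronoi_graph \<omega>) \<inter> B)"
    by (rule rev_finite_subset) (force simp: voronoi_graph_def)
qed

text \<open>A continuous function attains its minimum on \<open>K\<close>, so values below every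
  \<open>1 / real (Suc n)\<close> force a zero; conversely, density of \<open>D\<close> supplies
  small values near a zero. This trades a quantifier over an uncountable set for countable
  ones.\<close>

lemma zero_in_compact_iff_dense:
  fixes F :: "'c::metric_space \<Rightarrow> real"
  assumes K: "compact K" and D: "D \<subseteq> K" "K \<subseteq> closure D"
    and F: "continuous_on UNIV F" "\<And>z. 0 \<le> F z"
  shows "(\<exists>z\<in>K. F z = 0) \<longleftrightarrow> (\<forall>n. \<exists>z\<in>D. F z < 1 / real (Suc n))"
proof
  assume "\<exists>z\<in>K. F z = 0"
  then obtain z where z: "z \<in> K" "F z = 0"
    by auto
  show "\<forall>n. \<exists>z\<in>D. F z < 1 / real (Suc n)"
  proof
    fix n
    have "open {w. F w < 1 / real (Suc n)}"
      using F(1) by (intro open_Collect_less continuous_intros)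
    moreover have "z \<in> {w. F w < 1 / real (Suc n)} \<inter> closure D"
      using z D(2) by auto
    ultimately show "\<exists>z\<in>D. F z < 1 / real (Suc n)"
      using open_Int_closure_eq_empty by blast
  qed
next
  assume *: "\<forall>n. \<exists>z\<in>D. F z < 1 / real (Suc n)"
  then have "K \<noteq> {}"
    using D(1) by auto
  then obtain z where z: "z \<in> K" "\<And>w. w \<in> K \<Longrightarrow> F z \<le> F w"
    using continuous_attains_inf[OF K _ continuous_on_subset[OF F(1)]] by blast
  have "\<not> 0 < F z"
  proof
    assume "0 < F z"
    then obtain n where "1 / real (Suc n) < F z"
      using nat_approx_posE by blast
    with * z(2) D(1) show False
      by (meson less_trans not_less subsetD)
  qed
  with F(2)[of z] z(1) show "\<exists>z\<in>K. F z = 0"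
    by force
qed

text \<open>
  An edge together with two points of the common side of its cells is a zero of this continuous
  function, whose values at fixed arguments depend measurably on the configuration.
\<close>

definition voronoi_defect :: "plane set \<Rightarrow> (plane \<times> plane) \<times> plane \<times> plane \<Rightarrow> real" where
  "voronoi_defect \<omega> = (\<lambda>((u, v), x, y). infdist u \<omega> + infdist v \<omega> +
     \<bar>dist x u - infdist x \<omega>\<bar> + \<bar>dist x v - infdist x \<omega>\<bar> +
     \<bar>dist y u - infdist y \<omega>\<bar> + \<bar>dist y v - infdist y \<omega>\<bar>)"

lemma voronoi_defect_nonneg: "0 \<le> voronoi_defect \<omega> z"
  by (auto simp: voronoi_defect_def infdist_nonneg split: prod.split intro!: add_nonneg_nonneg)

lemma continuous_voronoi_defect: "continuous_on UNIV (voronoi_defect \<omega>)"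
  unfolding voronoi_defect_def case_prod_unfold by (intro continuous_intros)

lemma measurable_voronoi_defect: "(\<lambda>\<omega>. voronoi_defect \<omega> z) \<in> borel_measurable config_space"
proof -
  have [measurable]: "(\<lambda>\<omega>. infdist w \<omega>) \<in> borel_measurable config_space" for w :: plane
    by (rule measurable_infdist)
  show ?thesis
    unfolding voronoi_defect_def case_prod_unfold by measurable
qed

lemma voronoi_defect_eq_0_iff:
  assumes "locally_finite \<omega>" "\<omega> \<noteq> {}"
  shows "voronoi_defect \<omega> ((u, v), x, y) = 0 \<longleftrightarrow>
    u \<in> \<omega> \<and> v \<in> \<omega> \<and> {x, y} \<subseteq> voronoi_cell \<omega> u \<inter> voronoi_cell \<omega> v"
proof -
  have "voronoi_defect \<omega> ((u, v), x, y) = 0 \<longleftrightarrow> infdist u \<omega> = 0 \<and> infdist v \<omega> = 0 \<and>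
      dist x u = infdist x \<omega> \<and> dist x v = infdist x \<omega> \<and> dist y u = infdist y \<omega> \<and> dist y v = infdist y \<omega>"
    using infdist_nonneg[of u \<omega>] infdist_nonneg[of v \<omega>] unfolding voronoi_defect_def by auto
  moreover have "infdist w \<omega> = 0 \<longleftrightarrow> w \<in> \<omega>" for w
    using in_closed_iff_infdist_zero[OF locally_finite_imp_closed] assms by metis
  ultimately show ?thesis
    using mem_voronoi_cell_iff[of _ \<omega>] by auto
qed

lemma measurable_voronoi_edges: "(\<lambda>\<omega>. snd (voronoi_graph \<omega>)) \<in> config_space \<rightarrow>\<^sub>M config_space"
proof (rule measurable_config_spaceI)
  fix C :: "(plane \<times> plane) set" assume C: "compact C"
  \<comment> \<open>The conditions \<open>u \<noteq> v\<close> and \<open>x \<noteq> y\<close> are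
    open and the points \<open>x\<close>, \<open>y\<close> unbounded. The sets \<open>K m\<close>
    exhaust this region by compact sets.\<close>
  define K where "K m = (C \<times> cball (0::plane) (real m) \<times> cball (0::plane) (real m)) \<inter>
      {z. 1 / real (Suc m) \<le> dist (fst (fst z)) (snd (fst z)) \<and>
          1 / real (Suc m) \<le> dist (fst (snd z)) (snd (snd z))}" for m
  have K: "compact (K m)" for m
    unfolding K_def
  proof (rule compact_Int_closed)
    show "compact (C \<times> cball (0::plane) (real m) \<times> cball (0::plane) (real m))"
      by (intro compact_Times C compact_cball)
    show "closed {z::(plane \<times> plane) \<times> plane \<times> plane.
        1 / real (Suc m) \<le> dist (fst (fst z)) (snd (fst z)) \<and>
        1 / real (Suc m) \<le> dist (fst (snd z)) (snd (snd z))}"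
      by (intro closed_Collect_conj closed_Collect_le continuous_on_const continuous_on_dist
        continuous_on_fst continuous_on_snd continuous_on_id)
  qed
  have "\<exists>D. countable D \<and> D \<subseteq> K m \<and> K m \<subseteq> closure D" for m
    using separable[of "K m"] by metis
  then obtain D where D: "\<And>m. countable (D m)" "\<And>m. D m \<subseteq> K m" "\<And>m. K m \<subseteq> closure (D m)"
    by metis
  have hit: "snd (voronoi_graph \<omega>) \<inter> C \<noteq> {} \<longleftrightarrow> (\<exists>m. \<exists>z\<in>K m. voronoi_defect \<omega> z = 0)"
    if \<omega>: "locally_finite \<omega>" "\<omega> \<noteq> {}" for \<omega>
  proof
    assume "snd (voronoi_graph \<omega>) \<inter> C \<noteq> {}"
    then obtain u v where uv: "(u, v) \<in> C" "(u, v) \<in> snd (voronoi_graph \<omega>)"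
      by auto
    then obtain x y where e: "(u, v) \<in> C" "u \<in> \<omega>" "v \<in> \<omega>" "u \<noteq> v" "x \<noteq> y"
      "{x, y} \<subseteq> voronoi_cell \<omega> u \<inter> voronoi_cell \<omega> v"
      unfolding mem_voronoi_edges by blast
    obtain i where i: "1 / real (Suc i) < dist u v"
      using e(4) nat_approx_posE[of "dist u v"] by auto
    obtain j where j: "1 / real (Suc j) < dist x y"
      using e(5) nat_approx_posE[of "dist x y"] by auto
    obtain k where k: "norm x + norm y \<le> real k"
      using real_arch_simple by blast
    \<comment> \<open>A single index that serves both lower bounds on distances and the bound on the
      norms.\<close>
    define m where "m = i + j + k"
    have "1 / real (Suc m) \<le> 1 / real (Suc i)" "1 / real (Suc m) \<le> 1 / real (Suc j)"
      by (auto simp: m_def frac_le)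
    moreover have "norm x \<le> real m" "norm y \<le> real m"
      using k norm_ge_zero[of x] norm_ge_zero[of y] unfolding m_def of_nat_add by linarith+
    ultimately have "((u, v), x, y) \<in> K m"
      using i j e(1) by (simp add: K_def del: of_nat_Suc)
    then show "\<exists>m. \<exists>z\<in>K m. voronoi_defect \<omega> z = 0"
      using e voronoi_defect_eq_0_iff[OF \<omega>] by blast
  next
    assume "\<exists>m. \<exists>z\<in>K m. voronoi_defect \<omega> z = 0"
    then obtain m u v x y where z: "((u, v), x, y) \<in> K m" "voronoi_defect \<omega> ((u, v), x, y) = 0"
      by (metis prod.collapse)
    have pos: "0 < 1 / real (Suc m)"
      by simp
    have "(u, v) \<in> C" "u \<noteq> v" "x \<noteq> y"
      using z(1) pos unfolding K_def by (auto simp del: of_nat_Suc)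
    moreover from this have "(u, v) \<in> snd (voronoi_graph \<omega>)"
      using z(2) unfolding voronoi_defect_eq_0_iff[OF \<omega>] mem_voronoi_edges by blast
    ultimately show "snd (voronoi_graph \<omega>) \<inter> C \<noteq> {}"
      by blast
  qed
  have [measurable]: "(\<lambda>\<omega>. voronoi_defect \<omega> z) \<in> borel_measurable config_space" for z
    by (rule measurable_voronoi_defect)
  \<comment> \<open>The empty configuration has no edges and is split off, since the zeros of
    \<open>voronoi_defect\<close> are characterised for nonempty configurations.\<close>
  have "Measurable.pred config_space
    (\<lambda>\<omega>. (\<forall>n::nat. \<omega> \<inter> cball (0::plane) (real n) = {}) \<or>
       \<not> (\<exists>m. \<forall>n. \<exists>z\<in>D m. voronoi_defect \<omega> z < 1 / real (Suc n)))"
    by (intro pred_intros_logic pred_intros_countable pred_Bex_countable D(1)) measurable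
  then show "Measurable.pred config_space (\<lambda>\<omega>. snd (voronoi_graph \<omega>) \<inter> C = {})"
  proof (rule measurable_cong[THEN iffD1, rotated])
    fix \<omega> :: "plane set" assume "\<omega> \<in> space config_space"
    then have lf: "locally_finite \<omega>"
      by (simp add: space_config_space)
    note ne = disjoint_cballs_iff_empty[of \<omega> 0]
    have dense: "(\<exists>z\<in>K m. voronoi_defect \<omega> z = 0) \<longleftrightarrow> (\<forall>n. \<exists>z\<in>D m. voronoi_defect \<omega> z < 1 / real (Suc n))" for m
      using zero_in_compact_iff_dense[OF K D(2,3) continuous_voronoi_defect voronoi_defect_nonneg] .
    show "((\<forall>n::nat. \<omega> \<inter> cball (0::plane) (real n) = {}) \<or>
       \<not> (\<exists>m. \<forall>n. \<exists>z\<in>D m. voronoi_defect \<omega> z < 1 / real (Suc n)))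
       \<longleftrightarrow> snd (voronoi_graph \<omega>) \<inter> C = {}"
    proof (cases "\<omega> = {}")
      case False
      then show ?thesis
        using hit[OF lf False] unfolding ne dense by blast
    qed (simp add: voronoi_graph_def)
  qed
qed (simp add: space_config_space locally_finite_voronoi_edges)

section \<open>The Voronoi graph as a random graph\<close>

lemma fst_voronoi_graph: "fst (voronoi_graph \<omega>) = \<omega>"
  by (simp add: voronoi_graph_def)

lemma measurable_voronoi_graph: "voronoi_graph \<in> config_space \<rightarrow>\<^sub>M graph_space"
  unfolding graph_space_def
proof (rule measurable_restrict_space2)
  show "voronoi_graph \<in> space config_space \<rightarrow> {(V, E). E \<subseteq> V \<times> V \<and> sym E \<and> irrefl E}"
    by (auto simp: voronoi_graph_def sym_def irrefl_def Int_commute)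
  have "(\<lambda>\<omega>. (\<omega>, snd (voronoi_graph \<omega>))) \<in> config_space \<rightarrow>\<^sub>M config_space \<Otimes>\<^sub>M config_space"
    using measurable_voronoi_edges by measurable
  then show "voronoi_graph \<in> config_space \<rightarrow>\<^sub>M config_space \<Otimes>\<^sub>M config_space"
    using fst_voronoi_graph by (metis (no_types, lifting) measurable_cong prod.collapse)
qed


section \<open>Equivariance under isometries\<close>

lemma plane_isometriesD:
  assumes "g \<in> plane_isometries"
  shows "bij g" "dist (g x) (g y) = dist x y" "g x = g y \<longleftrightarrow> x = y"
  using assms by (simp_all add: plane_isometries_def bij_is_inj inj_eq)

lemma inv_plane_isometries:
  assumes "g \<in> plane_isometries"
  shows "inv_into UNIV g \<in> plane_isometries"
proof -
  have "dist (inv_into UNIV g x) (inv_into UNIV g y) = dist x y" for x y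
    using plane_isometriesD(2)[OF assms, of "inv_into UNIV g x" "inv_into UNIV g y"]
      plane_isometriesD(1)[OF assms] by (simp add: bij_is_surj surj_f_inv_f)
  then show ?thesis
    using plane_isometriesD(1)[OF assms] by (simp add: plane_isometries_def bij_imp_bij_inv)
qed

lemma bounded_image_isometry:
  assumes "g \<in> plane_isometries" "bounded B"
  shows "bounded (g ` B)"
proof -
  obtain x e where "\<And>y. y \<in> B \<Longrightarrow> dist x y \<le> e"
    using assms(2) unfolding bounded_def by blast
  then have "\<forall>y\<in>g ` B. dist (g x) y \<le> e"
    using plane_isometriesD(2)[OF assms(1)] by simp
  then show ?thesis
    unfolding bounded_def by blast
qed

lemma continuous_isometry:
  assumes "g \<in> plane_isometries"
  shows "continuous_on S g"
  unfolding continuous_on_iff plane_isometriesD(2)[OF assms] by blast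

text \<open>Reduces void events of the image configuration to void events of the original one, for
  the preimage of \<open>C\<close>.\<close>

lemma image_isometry_Int_eq:
  assumes "g \<in> plane_isometries"
  shows "g ` \<omega> \<inter> C = g ` (\<omega> \<inter> inv_into UNIV g ` C)"
proof -
  have "g ` inv_into UNIV g ` C = C"
    using plane_isometriesD(1)[OF assms] by (intro image_f_inv_f bij_is_surj)
  then show ?thesis
    using image_Int[OF bij_is_inj[OF plane_isometriesD(1)[OF assms]]] by simp
qed

lemma locally_finite_image_isometry:
  assumes "g \<in> plane_isometries" "locally_finite \<omega>"
  shows "locally_finite (g ` \<omega>)"
  unfolding locally_finite_def
proof (intro allI impI)
  fix B :: "plane set" assume "bounded B"
  then have "finite (\<omega> \<inter> inv_into UNIV g ` B)"
    by (intro locally_finiteD assms bounded_image_isometry inv_plane_isometries)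
  then show "finite (g ` \<omega> \<inter> B)"
    by (subst image_isometry_Int_eq[OF assms(1)]) simp
qed

lemma measurable_image_isometry:
  assumes g: "g \<in> plane_isometries"
  shows "(\<lambda>\<omega>. g ` \<omega>) \<in> config_space \<rightarrow>\<^sub>M config_space"
proof (rule measurable_config_spaceI)
  fix C :: "plane set" assume "compact C"
  then have "compact (inv_into UNIV g ` C)"
    by (intro compact_continuous_image continuous_isometry inv_plane_isometries g)
  then have "Measurable.pred config_space (\<lambda>\<omega>. \<omega> \<inter> inv_into UNIV g ` C = {})"
    by (intro pred_void_config_space borel_closed compact_imp_closed compact_imp_bounded)
  then show "Measurable.pred config_space (\<lambda>\<omega>. g ` \<omega> \<inter> C = {})"
    by (subst image_isometry_Int_eq[OF g]) simp
qed (simp add: space_config_space locally_finite_image_isometry g)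

section \<open>Isometries acting on Voronoi graphs\<close>

lemma voronoi_cell_image:
  assumes "g \<in> plane_isometries"
  shows "g x \<in> voronoi_cell (g ` \<omega>) (g u) \<longleftrightarrow> x \<in> voronoi_cell \<omega> u"
  using plane_isometriesD(2)[OF assms] by (auto simp: voronoi_cell_def)

text \<open>Cells are defined by distances alone, so an isometry carries two distinct points of a
  common face to two distinct points of the image face.\<close>

lemma voronoi_graph_image:
  assumes g: "g \<in> plane_isometries"
  shows "voronoi_graph (g ` \<omega>) = graph_image g (voronoi_graph \<omega>)"
proof -
  have surj: "\<exists>x. y = g x" for y
    using plane_isometriesD(1)[OF g] bij_is_surj by (metis surjD)
  have edge: "(g u, g v) \<in> snd (voronoi_graph (g ` \<omega>)) \<longleftrightarrow> (u, v) \<in> snd (voronoi_graph \<omega>)" for u v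
  proof -
    \<comment> \<open>Surjectivity allows any two points of the image face to be written as
      \<open>g x\<close> and \<open>g y\<close>.\<close>
    have "(\<exists>x y. x \<noteq> y \<and> {x, y} \<subseteq> voronoi_cell (g ` \<omega>) (g u) \<inter> voronoi_cell (g ` \<omega>) (g v)) \<longleftrightarrow>
      (\<exists>x y. g x \<noteq> g y \<and> {g x, g y} \<subseteq> voronoi_cell (g ` \<omega>) (g u) \<inter> voronoi_cell (g ` \<omega>) (g v))"
      using surj by metis
    then show ?thesis
      by (auto simp: mem_voronoi_edges voronoi_cell_image[OF g] plane_isometriesD(3)[OF g])
  qed
  have "snd (voronoi_graph (g ` \<omega>)) = map_prod g g ` snd (voronoi_graph \<omega>)"
  proof (rule Set.set_eqI)
    fix e
    obtain u v where e: "e = (g u, g v)"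
      using surj by (metis prod.collapse)
    have "(g u, g v) \<in> map_prod g g ` snd (voronoi_graph \<omega>) \<longleftrightarrow> (u, v) \<in> snd (voronoi_graph \<omega>)"
      by (auto simp: plane_isometriesD(3)[OF g])
    then show "e \<in> snd (voronoi_graph (g ` \<omega>)) \<longleftrightarrow> e \<in> map_prod g g ` snd (voronoi_graph \<omega>)"
      using edge by (simp add: e)
  qed
  then show ?thesis
    by (simp add: prod_eq_iff graph_image_def case_prod_unfold) (simp add: voronoi_graph_def)
qed

lemma invariant_random_graph_voronoi:
  assumes \<Gamma>: "\<Gamma> \<subseteq> plane_isometries" and X: "point_process M X" and inv: "invariant_process \<Gamma> M X"
  shows "invariant_random_graph \<Gamma> M (\<lambda>x. voronoi_graph (X x))"
  unfolding invariant_random_graph_def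
proof (intro conjI ballI)
  have X': "X \<in> M \<rightarrow>\<^sub>M config_space" and "prob_space M"
    using X by (auto simp: point_process_def)
  then show "prob_space M" "(\<lambda>x. voronoi_graph (X x)) \<in> M \<rightarrow>\<^sub>M graph_space"
    using measurable_compose[OF _ measurable_voronoi_graph] by auto
  fix g assume "g \<in> \<Gamma>"
  with \<Gamma> have g: "g \<in> plane_isometries"
    by auto
  have gX: "(\<lambda>x. g ` X x) \<in> M \<rightarrow>\<^sub>M config_space"
    using measurable_compose[OF X' measurable_image_isometry[OF g]] .
  \<comment> \<open>By equivariance, the transformed graph is the Voronoi graph of the transformed
    process, and the law of a Voronoi graph is the push-forward of the law of its process.\<close>
  have "distr M graph_space (\<lambda>x. graph_image g (voronoi_graph (X x)))
      = distr M graph_space (voronoi_graph \<circ> (\<lambda>x. g ` X x))"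
    by (simp add: voronoi_graph_image[OF g] comp_def)
  also have "\<dots> = distr (distr M config_space (\<lambda>x. g ` X x)) graph_space voronoi_graph"
    by (rule distr_distr[symmetric, OF measurable_voronoi_graph gX])
  also have "\<dots> = distr (distr M config_space X) graph_space voronoi_graph"
    using inv \<open>g \<in> \<Gamma>\<close> by (simp add: invariant_process_def)
  also have "\<dots> = distr M graph_space (\<lambda>x. voronoi_graph (X x))"
    by (simp add: distr_distr[OF measurable_voronoi_graph X'] comp_def)
  finally show "distr M graph_space (\<lambda>x. graph_image g (voronoi_graph (X x)))
      = distr M graph_space (\<lambda>x. voronoi_graph (X x))" .
qed


section \<open>Regular decay\<close>

lemma long_edge_imp_empty_ball:
  fixes \<omega> :: "plane set"
  assumes e: "(u, v) \<in> snd (voronoi_graph \<omega>)" "u \<in> cball p R" "v \<in> cball p R"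
    and \<rho>: "0 < \<rho>" "2 * \<rho> \<le> dist u v"
  obtains y where "y \<in> cball p (2 * R)" "\<omega> \<inter> ball y \<rho> = {}" "\<omega> \<noteq> {}"
proof -
  obtain x where x: "x \<in> voronoi_cell \<omega> u" "x \<in> voronoi_cell \<omega> v" and uv: "u \<in> \<omega>" "v \<in> \<omega>"
    using e(1) mem_voronoi_edges by auto
  define t where "t = dist x u"
  have "dist x v = t"
    using x uv by (auto simp: t_def voronoi_cell_def intro: antisym)
  then have t: "\<rho> \<le> t"
    using dist_triangle3[of u v x] \<rho>(2) by (simp add: t_def)
  \<comment> \<open>The point at distance \<open>\<rho>\<close> from \<open>u\<close> on the segment
    from \<open>u\<close> to \<open>x\<close>. The disc \<open>ball y \<rho>\<close> is internally
    tangent at \<open>u\<close> to the empty disc of radius \<open>t\<close> around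
    \<open>x\<close>, hence empty too.\<close>
  define y where "y = u + (\<rho> / t) *\<^sub>R (x - u)"
  \<comment> \<open>With \<open>2 * \<rho> \<le> dist u v\<close> this gives
    \<open>\<rho> \<le> R\<close>, so \<open>y\<close> is within
    \<open>R + \<rho> \<le> 2 * R\<close> of \<open>p\<close>.\<close>
  have "dist u v \<le> 2 * R"
    using dist_triangle3[of u v p] e(2,3) by simp
  moreover have yu: "dist y u = \<rho>"
    using t \<rho>(1) by (simp add: y_def dist_norm) (auto simp: t_def dist_norm)
  ultimately have "y \<in> cball p (2 * R)"
    using dist_triangle[of p y u] e(2) \<rho>(2) by (simp add: dist_commute)
  moreover have "\<omega> \<inter> ball y \<rho> = {}"
  proof -
    have "x - y = (1 - \<rho> / t) *\<^sub>R (x - u)"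
      by (simp add: y_def algebra_simps)
    then have "dist x y = (1 - \<rho> / t) * t"
    proof -
      have "0 \<le> 1 - \<rho> / t"
        using t \<rho>(1) by simp
      then show ?thesis
        using \<open>x - y = _\<close> by (simp add: dist_norm t_def)
    qed
    also have "\<dots> = t - \<rho>"
      using t \<rho>(1) by (simp add: field_simps)
    finally have xy: "dist x y = t - \<rho>" .
    have "\<rho> \<le> dist y w" if "w \<in> \<omega>" for w
    proof -
      have "t \<le> dist x w"
        using x(1) that by (simp add: voronoi_cell_def t_def)
      with dist_triangle[of x w y] xy show ?thesis
        by simp
    qed
    then show ?thesis
      by force
  qed
  ultimately show ?thesis
    using that uv by blast
qed

text \<open>The empty configuration is excluded: it may have positive probability, and then plain
  void probabilities would not tend to 0. It has no edges, so nothing is lost.\<close>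

definition void_prob :: "'a measure \<Rightarrow> ('a \<Rightarrow> plane set) \<Rightarrow> plane \<Rightarrow> real \<Rightarrow> real" where
  "void_prob M X c s = measure M {x \<in> space M. X x \<inter> cball c s = {} \<and> X x \<noteq> {}}"

lemma pred_void_nonempty:
  "Measurable.pred config_space (\<lambda>\<omega>. \<omega> \<inter> cball c s = {} \<and> \<omega> \<noteq> ({}::plane set))"
proof -
  have "Measurable.pred config_space
      (\<lambda>\<omega>. \<omega> \<inter> cball c s = {} \<and> \<not> (\<forall>n::nat. \<omega> \<inter> cball (0::plane) (real n) = {}))"
    by measurable
  then show ?thesis
    unfolding disjoint_cballs_iff_empty .
qed

lemma sets_void_nonempty:
  assumes "X \<in> M \<rightarrow>\<^sub>M config_space"
  shows "{x \<in> space M. X x \<inter> cball c s = {} \<and> X x \<noteq> ({}::plane set)} \<in> sets M"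
  using measurable_compose[OF assms pred_void_nonempty] by (simp add: pred_def)

lemma void_prob_eq_distr:
  assumes "X \<in> M \<rightarrow>\<^sub>M config_space"
  shows "void_prob M X c s =
    measure (distr M config_space X) {\<omega> \<in> space config_space. \<omega> \<inter> cball c s = {} \<and> \<omega> \<noteq> {}}"
proof -
  have "X -` {\<omega> \<in> space config_space. \<omega> \<inter> cball c s = {} \<and> \<omega> \<noteq> {}} \<inter> space M
      = {x \<in> space M. X x \<inter> cball c s = {} \<and> X x \<noteq> {}}"
    using measurable_space[OF assms] by auto
  then show ?thesis
    using pred_void_nonempty[of c s] by (simp add: void_prob_def measure_distr[OF assms] pred_def)
qed

text \<open>Some \<open>g\<close> in the group moves \<open>p\<close> to \<open>c\<close>.
  Invariance replaces \<open>X\<close> by its image under \<open>g\<close>, and the isometry pulls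
  the disc around \<open>c\<close> back to the one around \<open>p\<close>.\<close>

lemma void_prob_center:
  assumes \<Gamma>: "transitive_isometry_group \<Gamma>" and X: "point_process M X" and inv: "invariant_process \<Gamma> M X"
  shows "void_prob M X c s = void_prob M X p s"
proof -
  have X': "X \<in> M \<rightarrow>\<^sub>M config_space"
    using X by (simp add: point_process_def)
  obtain g where "g \<in> \<Gamma>" and g: "g \<in> plane_isometries" and gp: "g p = c"
    using \<Gamma> unfolding transitive_isometry_group_def by blast
  have gX: "(\<lambda>x. g ` X x) \<in> M \<rightarrow>\<^sub>M config_space"
    using measurable_compose[OF X' measurable_image_isometry[OF g]] .
  have "void_prob M X c s = void_prob M (\<lambda>x. g ` X x) c s"
    using inv \<open>g \<in> \<Gamma>\<close>
    by (simp add: void_prob_eq_distr[OF X'] void_prob_eq_distr[OF gX] invariant_process_def)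
  also have "\<dots> = void_prob M X p s"
  proof -
    have "g ` X x \<inter> cball c s = {} \<longleftrightarrow> X x \<inter> cball p s = {}" for x
      unfolding gp[symmetric] disjoint_iff ball_simps mem_cball
      using plane_isometriesD(2)[OF g] by (metis imageE imageI)
    then show ?thesis
      by (simp add: void_prob_def)
  qed
  finally show ?thesis .
qed

text \<open>The events decrease along integer radii and have empty intersection, because a nonempty
  configuration has a point at finite distance from \<open>p\<close>. Continuity from above then
  applies.\<close>

lemma void_prob_small:
  assumes X: "point_process M X" and e: "0 < e"
  obtains s0 where "\<And>s. s0 \<le> s \<Longrightarrow> void_prob M X p s < e"
proof -
  interpret prob_space M
    using X by (simp add: point_process_def)
  have X': "X \<in> M \<rightarrow>\<^sub>M config_space"
    using X by (simp add: point_process_def)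
  let ?A = "\<lambda>s. {x \<in> space M. X x \<inter> cball p s = {} \<and> X x \<noteq> {}}"
  have sets: "?A s \<in> sets M" for s
    by (rule sets_void_nonempty[OF X'])
  have mono: "?A s' \<subseteq> ?A s" if "s \<le> s'" for s s'
    using that subset_cball[OF that, of p] by blast
  have "(\<Inter>n::nat. ?A (real n)) = {}"
  proof (rule equals0I)
    fix x assume x: "x \<in> (\<Inter>n::nat. ?A (real n))"
    then obtain w where "w \<in> X x"
      by auto
    moreover obtain n :: nat where "dist p w \<le> real n"
      using real_arch_simple by blast
    ultimately have "x \<notin> ?A (real n)"
      by auto
    with x show False
      by blast
  qed
  moreover have "(\<lambda>n. prob (?A (real n))) \<longlonglongrightarrow> prob (\<Inter>n. ?A (real n))"
    by (rule finite_Lim_measure_decseq) (use sets mono in \<open>auto simp: decseq_def intro!: mono\<close>)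
  ultimately have "(\<lambda>n. prob (?A (real n))) \<longlonglongrightarrow> 0"
    by simp
  then have "eventually (\<lambda>n. prob (?A (real n)) < e) sequentially"
    by (rule order_tendstoD(2)) (rule e)
  then obtain n where n: "prob (?A (real n)) < e"
    by (auto simp: eventually_sequentially)
  show ?thesis
  proof (rule that)
    fix s assume "real n \<le> s"
    then show "void_prob M X p s < e"
      using finite_measure_mono[OF mono[of "real n" s] sets] n by (simp add: void_prob_def)
  qed
qed

text \<open>
  After rescaling by \<open>R\<close> the number of balls needed to detect all long edges depends only on
  \<open>\<delta>\<close>.
\<close>

lemma long_edge_prob_small:
  assumes \<Gamma>: "transitive_isometry_group \<Gamma>" and X: "point_process M X" and inv: "invariant_process \<Gamma> M X"
    and \<delta>: "0 < \<delta>"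
  obtains r0 where "\<And>R. 0 < R \<Longrightarrow> r0 \<le> R \<Longrightarrow>
    \<P>(x in M. \<exists>u v. (u, v) \<in> snd (voronoi_graph (X x)) \<and> u \<in> cball p R \<and> v \<in> cball p R \<and>
                          dist u v \<ge> \<delta> * R / 6) < \<delta>"
proof -
  interpret prob_space M
    using X by (simp add: point_process_def)
  have X': "X \<in> M \<rightarrow>\<^sub>M config_space"
    using X by (simp add: point_process_def)
  \<comment> \<open>The net is fixed before \<open>R\<close>. Scaling \<open>cball 0 2\<close> by
    \<open>R\<close> and translating gives \<open>cball p (2 * R)\<close>, where the centres of the
    empty discs lie.\<close>
  obtain F :: "plane set" where F: "finite F" "cball 0 2 \<subseteq> (\<Union>c\<in>F. ball c (\<delta> / 24))"
    using compact_eq_totally_bounded[THEN iffD1, OF compact_cball, THEN conjunct2, rule_format,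
        of "\<delta> / 24" "0::plane" 2] \<delta> by auto
  \<comment> \<open>The summand 1 makes the final union bound
    \<open>real (card F) * (\<delta> / ?N)\<close> strictly smaller than
    \<open>\<delta>\<close>.\<close>
  let ?N = "real (card F) + 1"
  obtain s0 where s0: "\<And>s. s0 \<le> s \<Longrightarrow> void_prob M X p s < \<delta> / ?N"
    using void_prob_small[OF X, of "\<delta> / ?N" p] \<delta> by auto
  let ?A = "\<lambda>c s. {x \<in> space M. X x \<inter> cball c s = {} \<and> X x \<noteq> {}}"
  show ?thesis
  proof (rule that)
    fix R assume R: "0 < R" "24 * s0 / \<delta> \<le> R"
    let ?E = "{x \<in> space M. \<exists>u v. (u, v) \<in> snd (voronoi_graph (X x)) \<and> u \<in> cball p R \<and> v \<in> cball p R \<and>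
                          dist u v \<ge> \<delta> * R / 6}"
    \<comment> \<open>This is the mesh of the scaled net. A long edge has length at least
      \<open>4 * s\<close> and yields an empty disc of radius \<open>2 * s\<close>; a net point
      within \<open>s\<close> of its centre then has an empty disc of radius
      \<open>s\<close>.\<close>
    define s where "s = \<delta> * R / 24"
    have "s0 \<le> s"
      using R \<delta> by (simp add: s_def field_simps)
    have "?E \<subseteq> (\<Union>c\<in>F. ?A (p + R *\<^sub>R c) s)"
    proof
      fix x assume "x \<in> ?E"
      then obtain u v where x: "x \<in> space M" "(u, v) \<in> snd (voronoi_graph (X x))"
        "u \<in> cball p R" "v \<in> cball p R" "dist u v \<ge> \<delta> * R / 6"
        by auto
      have "0 < 2 * s" "2 * (2 * s) \<le> dist u v"
        using \<delta> R(1) x(5) by (simp_all add: s_def mult.commute)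
      then obtain y where y: "y \<in> cball p (2 * R)" "X x \<inter> ball y (2 * s) = {}" "X x \<noteq> {}"
        using long_edge_imp_empty_ball[OF x(2-4)] by blast
      define z where "z = (1 / R) *\<^sub>R (y - p)"
      have yz: "y = p + R *\<^sub>R z"
        using R(1) by (simp add: z_def)
      have "norm z \<le> 2"
        using y(1) R(1) by (simp add: z_def dist_norm norm_minus_commute divide_le_eq)
      then have "z \<in> cball 0 2"
        by simp
      with F(2) obtain c where c: "c \<in> F" "dist c z < \<delta> / 24"
        by auto
      have "dist (p + R *\<^sub>R c) y = R * dist c z"
        using R(1) by (simp add: yz dist_norm flip: scaleR_diff_right)
      also have "\<dots> < s"
        using c(2) R(1) by (simp add: s_def field_simps)
      finally have "cball (p + R *\<^sub>R c) s \<subseteq> ball y (2 * s)"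
        by (subst cball_subset_ball_iff) (simp add: dist_commute)
      with y x(1) have "x \<in> ?A (p + R *\<^sub>R c) s"
        by blast
      with c(1) show "x \<in> (\<Union>c\<in>F. ?A (p + R *\<^sub>R c) s)"
        by blast
    qed
    then have "prob ?E \<le> prob (\<Union>c\<in>F. ?A (p + R *\<^sub>R c) s)"
      by (rule finite_measure_mono) (intro sets.finite_UN F(1) sets_void_nonempty[OF X'])
    also have "\<dots> \<le> (\<Sum>c\<in>F. prob (?A (p + R *\<^sub>R c) s))"
      by (rule finite_measure_subadditive_finite) (use F(1) sets_void_nonempty[OF X'] in auto)
    also have "\<dots> = (\<Sum>c\<in>F. void_prob M X (p + R *\<^sub>R c) s)"
      by (simp add: void_prob_def)
    also have "\<dots> = (\<Sum>c\<in>F. void_prob M X p s)"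
      by (intro sum.cong refl void_prob_center[OF \<Gamma> X inv])
    also have "\<dots> = real (card F) * void_prob M X p s"
      by simp
    also have "\<dots> \<le> real (card F) * (\<delta> / ?N)"
      using s0[OF \<open>s0 \<le> s\<close>] by (intro mult_left_mono) auto
    also have "\<dots> < \<delta>"
      using \<delta> by (simp add: field_simps)
    finally show "prob ?E < \<delta>" .
  qed
qed

text \<open>
  No monotonicity in \<open>\<delta>\<close> is assumed, so \<open>a r\<close> cannot be read off the infimum of the admissible
  \<open>\<delta>\<close>; it is an admissible \<open>\<delta>\<close> within \<open>1 / r\<close> of that infimum.
\<close>

lemma decay_rate_exists:
  fixes P :: "real \<Rightarrow> real \<Rightarrow> real"
  assumes b: "0 < b" "\<And>R. 0 < R \<Longrightarrow> P b R < b"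
    and small: "\<And>\<delta>. 0 < \<delta> \<Longrightarrow> \<exists>r0. \<forall>R>0. r0 \<le> R \<longrightarrow> P \<delta> R < \<delta>"
  shows "\<exists>a. (a \<longlongrightarrow> 0) at_top \<and> (\<forall>r R. 0 < r \<and> r \<le> R \<longrightarrow> P (a r) R < a r)"
proof -
  define S where "S r = {\<delta>. 0 < \<delta> \<and> (\<forall>R\<ge>r. P \<delta> R < \<delta>)}" for r
  have bdd: "bdd_below (S r)" for r
    by (rule bdd_belowI[of _ 0]) (simp add: S_def)
  have "\<exists>\<delta>. \<delta> \<in> S r \<and> \<delta> < Inf (S r) + 1 / r" if "0 < r" for r
  proof -
    \<comment> \<open>The crude rate \<open>b\<close> makes every \<open>S r\<close> nonempty, so
      that its infimum can be approached from within.\<close>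
    have "b \<in> S r"
      using b that by (simp add: S_def)
    then show ?thesis
      using cInf_lessD[of "S r" "Inf (S r) + 1 / r"] that by auto
  qed
  then obtain a where a: "\<And>r. 0 < r \<Longrightarrow> a r \<in> S r" "\<And>r. 0 < r \<Longrightarrow> a r < Inf (S r) + 1 / r"
    by metis
  have "(a \<longlongrightarrow> 0) at_top"
  proof (rule order_tendstoI)
    fix e :: real assume "e < 0"
    then show "eventually (\<lambda>r. e < a r) at_top"
      using a(1) by (intro eventually_mono[OF eventually_gt_at_top[of 0]]) (force simp: S_def)
  next
    \<comment> \<open>Half of \<open>e\<close> bounds the infimum, as \<open>e / 2\<close> becomes
      admissible; the other half bounds the error \<open>1 / r\<close>, which is why
      \<open>r\<close> must exceed \<open>2 / e\<close>.\<close>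
    fix e :: real assume e: "0 < e"
    then obtain r0 where r0: "\<forall>R>0. r0 \<le> R \<longrightarrow> P (e / 2) R < e / 2"
      using small[of "e / 2"] by auto
    show "eventually (\<lambda>r. a r < e) at_top"
    proof (rule eventually_mono[OF eventually_gt_at_top[of "max 0 (max r0 (2 / e))"]])
      fix r assume r: "max 0 (max r0 (2 / e)) < r"
      then have "e / 2 \<in> S r"
        using r0 e by (simp add: S_def)
      then have "Inf (S r) \<le> e / 2"
        by (rule cInf_lower[OF _ bdd])
      moreover have "1 / r < e / 2"
        using r e by (simp add: field_simps)
      ultimately show "a r < e"
        using a(2)[of r] r by simp
    qed
  qed
  with a(1) show ?thesis
    by (force simp: S_def)
qed

lemma regular_decay_voronoi:
  assumes \<Gamma>: "transitive_isometry_group \<Gamma>" and X: "point_process M X" and inv: "invariant_process \<Gamma> M X"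
  shows "regular_decay p M (\<lambda>x. voronoi_graph (X x))"
  unfolding regular_decay_def
proof (rule decay_rate_exists)
  \<comment> \<open>Two points of the disc are at distance at most
    \<open>2 * R = 12 * R / 6\<close>, so for the rate 13 the event is impossible.\<close>
  show "(0::real) < 13"
    by simp
  fix R :: real assume "0 < R"
  have "{x \<in> space M. \<exists>u v. (u, v) \<in> snd (voronoi_graph (X x)) \<and> u \<in> cball p R \<and> v \<in> cball p R \<and>
                          dist u v \<ge> 13 * R / 6} = {}"
  proof -
    have "dist u v < 13 * R / 6" if "u \<in> cball p R" "v \<in> cball p R" for u v
      using dist_triangle3[of u v p] that \<open>0 < R\<close> by simp
    then show ?thesis
      by force
  qed
  then show "\<P>(x in M. \<exists>u v. (u, v) \<in> snd (voronoi_graph (X x)) \<and> u \<in> cball p R \<and> v \<in> cball p R \<and>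
                          dist u v \<ge> 13 * R / 6) < 13"
    by (simp only:) simp
next
  fix \<delta> :: real assume "0 < \<delta>"
  show "\<exists>r0. \<forall>R>0. r0 \<le> R \<longrightarrow>
    \<P>(x in M. \<exists>u v. (u, v) \<in> snd (voronoi_graph (X x)) \<and> u \<in> cball p R \<and> v \<in> cball p R \<and>
                          dist u v \<ge> \<delta> * R / 6) < \<delta>"
    by (rule long_edge_prob_small[OF \<Gamma> X inv \<open>0 < \<delta>\<close>, of p]) blast
qed


section \<open>The Poisson process\<close>

lemma transitive_plane_isometries: "transitive_isometry_group plane_isometries"
  unfolding transitive_isometry_group_def
proof (intro conjI allI)
  have Bij: "Bij UNIV = {g. bij g}"
    by (auto simp: Bij_def)
  show "subgroup plane_isometries (BijGroup UNIV)"
  proof (rule group.subgroupI[OF group_BijGroup])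
    show "plane_isometries \<subseteq> carrier (BijGroup UNIV)"
      by (auto simp: BijGroup_def Bij plane_isometries_def)
    have "id \<in> plane_isometries"
      by (simp add: plane_isometries_def)
    then show "plane_isometries \<noteq> {}"
      by blast
    fix g assume g: "g \<in> plane_isometries"
    then have "inv\<^bsub>BijGroup UNIV\<^esub> g = inv_into UNIV g"
      using plane_isometriesD(1) by (subst inv_BijGroup) (auto simp: Bij)
    with inv_plane_isometries[OF g] show "inv\<^bsub>BijGroup UNIV\<^esub> g \<in> plane_isometries"
      by simp
    fix h assume h: "h \<in> plane_isometries"
    have "g \<otimes>\<^bsub>BijGroup UNIV\<^esub> h = g \<circ> h"
      using plane_isometriesD(1)[OF g] plane_isometriesD(1)[OF h]
      by (auto simp: BijGroup_def Bij compose_def)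
    moreover have "g \<circ> h \<in> plane_isometries"
      using g h by (auto simp: plane_isometries_def intro: bij_comp)
    ultimately show "g \<otimes>\<^bsub>BijGroup UNIV\<^esub> h \<in> plane_isometries"
      by simp
  qed
  fix x y :: plane
  have "(+) (y - x) \<in> plane_isometries"
    by (simp add: plane_isometries_def)
  then show "\<exists>g\<in>plane_isometries. g x = y"
    by (rule bexI[rotated]) simp
qed simp

lemma measure_image_isometry:
  assumes g: "g \<in> plane_isometries" and C: "compact C"
  shows "measure lborel (g ` C) = measure lborel C"
proof -
  \<comment> \<open>Splits \<open>g\<close> into a translation by \<open>g 0\<close> and an isometry
    fixing the origin. The latter is an orthogonal transformation, and Lebesgue measure is invariant
    under both.\<close>
  define f where "f x = g x - g 0" for x
  have f: "orthogonal_transformation f"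
    unfolding orthogonal_transformation_isometry
    using plane_isometriesD(2)[OF g] by (simp add: f_def dist_norm)
  have "compact (g ` C)"
    by (intro compact_continuous_image continuous_isometry g C)
  then have "measure lborel (g ` C) = measure lebesgue (g ` C)"
    by (simp add: compact_imp_closed borel_closed)
  also have "\<dots> = measure lebesgue ((+) (g 0) ` (f ` C))"
    by (simp add: f_def image_image)
  also have "\<dots> = measure lebesgue (f ` C)"
    by (rule measure_translation)
  also have "\<dots> = measure lebesgue C"
    by (rule measure_orthogonal_image[OF f lmeasurable_compact[OF C]])
  also have "\<dots> = measure lborel C"
    using C by (simp add: compact_imp_closed borel_closed)
  finally show ?thesis .
qed

text \<open>Void events are stable under intersection, so void probabilities determine the distribution.\<close>

lemma distr_config_space_eqI:
  fixes X Y :: "'a \<Rightarrow> 'b::euclidean_space set"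
  assumes M: "prob_space M" and X: "X \<in> M \<rightarrow>\<^sub>M config_space" and Y: "Y \<in> M \<rightarrow>\<^sub>M config_space"
    and eq: "\<And>C. compact C \<Longrightarrow> \<P>(x in M. X x \<inter> C = {}) = \<P>(x in M. Y x \<inter> C = {})"
  shows "distr M config_space X = distr M config_space Y"
proof (rule measure_eqI_generator_eq)
  interpret prob_space M
    by (rule M)
  let ?\<Omega> = "{\<omega>. locally_finite \<omega>} :: 'b set set"
  let ?E = "{{\<omega>. locally_finite \<omega> \<and> \<omega> \<inter> C = {}} | C. compact C} :: 'b set set set"
  show "Int_stable ?E"
  proof (rule Int_stableI)
    fix A B assume "A \<in> ?E" "B \<in> ?E"
    then obtain C C' where "compact C" "A = {\<omega>. locally_finite \<omega> \<and> \<omega> \<inter> C = {}}"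
      "compact C'" "B = {\<omega>. locally_finite \<omega> \<and> \<omega> \<inter> C' = {}}"
      by blast
    then have "compact (C \<union> C')" "A \<inter> B = {\<omega>. locally_finite \<omega> \<and> \<omega> \<inter> (C \<union> C') = {}}"
      by auto
    then show "A \<inter> B \<in> ?E"
      by blast
  qed
  show "?E \<subseteq> Pow ?\<Omega>"
    by auto
  show "sets (distr M config_space X) = sigma_sets ?\<Omega> ?E" "sets (distr M config_space Y) = sigma_sets ?\<Omega> ?E"
    by (simp_all add: sets_config_space_void)
  show "range (\<lambda>_::nat. ?\<Omega>) \<subseteq> ?E"
  proof -
    \<comment> \<open>The whole space is itself a void event, that of the empty compact set, so a
      constant sequence exhausts it.\<close>
    have "?\<Omega> = {\<omega>. locally_finite \<omega> \<and> \<omega> \<inter> {} = {}}"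
      by simp
    then show ?thesis
      using compact_empty by blast
  qed
  show "(\<Union>i::nat. ?\<Omega>) = ?\<Omega>"
    by simp
  show "emeasure (distr M config_space X) ?\<Omega> \<noteq> \<infinity>"
    using prob_space.emeasure_space_1[OF prob_space_distr[OF X]]
    by (simp add: space_config_space)
  fix A assume A: "A \<in> ?E"
  then obtain C where C: "compact C" "A = {\<omega>. locally_finite \<omega> \<and> \<omega> \<inter> C = {}}"
    by blast
  have "A \<in> sets config_space"
    using A by (simp add: sets_config_space_void sigma_sets.Basic)
  then have "emeasure (distr M config_space Z) A = \<P>(x in M. Z x \<inter> C = {})"
    if "Z \<in> M \<rightarrow>\<^sub>M config_space" for Z
  proof -
    have "Z -` A \<inter> space M = {x \<in> space M. Z x \<inter> C = {}}"
      using measurable_space[OF that] by (auto simp: C(2) space_config_space)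
    then show ?thesis
      using \<open>A \<in> sets config_space\<close> that by (simp add: emeasure_distr emeasure_eq_measure)
  qed
  from this[OF X] this[OF Y] eq[OF C(1)]
  show "emeasure (distr M config_space X) A = emeasure (distr M config_space Y) A"
    by simp
qed

text \<open>The void probability of \<open>C\<close> depends only on its area, which isometries
  preserve, and void probabilities determine the law.\<close>

lemma poisson_invariant:
  assumes "homogeneous_poisson_process lam N Y"
  shows "invariant_process plane_isometries N Y"
  unfolding invariant_process_def
proof
  fix g assume g: "g \<in> plane_isometries"
  have N: "prob_space N" and Y: "Y \<in> N \<rightarrow>\<^sub>M config_space"
    using assms by (auto simp: homogeneous_poisson_process_def point_process_def)
  have void: "\<P>(x in N. Y x \<inter> C = {}) = exp (- (lam * measure lborel C))" if C: "compact C" for C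
  proof -
    have "\<P>(x in N. card (Y x \<inter> C) = 0) = exp (- (lam * measure lborel C))"
      using assms that unfolding homogeneous_poisson_process_def
      by (auto simp: compact_imp_bounded compact_imp_closed borel_closed)
    \<comment> \<open>Local finiteness excludes the infinite sets, whose \<open>card\<close> is 0 as
      well.\<close>
    moreover have "card (Y x \<inter> C) = 0 \<longleftrightarrow> Y x \<inter> C = {}" if "x \<in> space N" for x
      using measurable_space[OF Y that] locally_finiteD[OF _ compact_imp_bounded[OF C]]
      by (simp add: space_config_space card_eq_0_iff)
    ultimately show ?thesis
      by (simp cong: conj_cong)
  qed
  show "distr N config_space (\<lambda>x. g ` Y x) = distr N config_space Y"
  proof (rule distr_config_space_eqI[OF N measurable_compose[OF Y measurable_image_isometry[OF g]] Y])
    fix C :: "plane set" assume C: "compact C"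
    have g': "inv_into UNIV g \<in> plane_isometries"
      by (rule inv_plane_isometries[OF g])
    have "compact (inv_into UNIV g ` C)"
      by (intro compact_continuous_image continuous_isometry g' C)
    moreover have "g ` Y x \<inter> C = {} \<longleftrightarrow> Y x \<inter> inv_into UNIV g ` C = {}" for x
      by (subst image_isometry_Int_eq[OF g]) simp
    ultimately show "\<P>(x in N. g ` Y x \<inter> C = {}) = \<P>(x in N. Y x \<inter> C = {})"
      using measure_image_isometry[OF g' C] by (simp add: void C)
  qed
qed

theorem proposition3p4:
  fixes p :: plane
    and \<Gamma> :: "(plane \<Rightarrow> plane) set"
    and M :: "'a measure" and X :: "'a \<Rightarrow> plane set"
    and N :: "'b measure" and Y :: "'b \<Rightarrow> plane set"
    and lam :: real
  shows "(transitive_isometry_group \<Gamma> \<and> point_process M X \<and> invariant_process \<Gamma> M X \<longrightarrow>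
            invariant_random_graph \<Gamma> M (\<lambda>x. voronoi_graph (X x)) \<and>
            regular_decay p M (\<lambda>x. voronoi_graph (X x))) \<and>
         (homogeneous_poisson_process lam N Y \<longrightarrow>
            invariant_random_graph plane_isometries N (\<lambda>x. voronoi_graph (Y x)) \<and>
            regular_decay p N (\<lambda>x. voronoi_graph (Y x)))"
proof (intro conjI impI)
  assume X: "transitive_isometry_group \<Gamma> \<and> point_process M X \<and> invariant_process \<Gamma> M X"
  then have "\<Gamma> \<subseteq> plane_isometries"
    by (simp add: transitive_isometry_group_def)
  with X show "invariant_random_graph \<Gamma> M (\<lambda>x. voronoi_graph (X x))"
    using invariant_random_graph_voronoi by blast
  from X show "regular_decay p M (\<lambda>x. voronoi_graph (X x))"
    using regular_decay_voronoi by blast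
next
  assume Y: "homogeneous_poisson_process lam N Y"
  then have Y': "point_process N Y"
    by (simp add: homogeneous_poisson_process_def)
  show "invariant_random_graph plane_isometries N (\<lambda>x. voronoi_graph (Y x))"
    by (rule invariant_random_graph_voronoi[OF subset_refl Y' poisson_invariant[OF Y]])
  show "regular_decay p N (\<lambda>x. voronoi_graph (Y x))"
    by (rule regular_decay_voronoi[OF transitive_plane_isometries Y' poisson_invariant[OF Y]])
qed

end
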